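(* Let $a,b\ge0$, $n\ge1$ and $T\in\mathrm{SHST}(a,b,n)$. Then the depth sequence of the reading word $\mathrm{rw}(T)$ depends only on the first row of $T$; in particular, for each $1\le j\le a+b$, $\mathrm{depth}_j(\mathrm{rw}(T))$ equals the number of entries equal to $j+1$ in the first row of $T$.
   Context: $\mathrm{SHST}(a,b,n)$ is the set of semistandard Young tableaux of shape $(n(a+1),n^b)$ (first row $n(a+1)$ boxes, then $b$ rows of $n$ boxes) with each of $1,\dots,a+b+1$ occurring exactly $n$ times. The reading word $\mathrm{rw}(T)$ lists entries row by row, left to right, bottom row first. For a word $w$ and $j\ge1$, $\mathrm{depth}_j(w)$: take the subword of letters $j,j+1$, repeatedly delete adjacent pairs "$j+1$ immediately followed by $j$"; the result is $j^r(j+1)^s$ and $\mathrm{depth}_j(w)=s$. The depth sequence is $(\mathrm{depth}_1(w),\mathrm{depth}_2(w),\dots)$. *)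

theory Defs
  imports Main
begin

text \<open>A tableau is the list of its rows, top row first (English convention).\<close>

definition semistandard :: "nat list list \<Rightarrow> bool" where
  "semistandard T \<longleftrightarrow>
     (\<forall>row \<in> set T. sorted row \<and> (\<forall>x \<in> set row. 1 \<le> x)) \<and>
     (\<forall>i c. Suc i < length T \<longrightarrow> c < length (T ! Suc i) \<longrightarrow> T ! i ! c < T ! Suc i ! c)"

definition SHST :: "nat \<Rightarrow> nat \<Rightarrow> nat \<Rightarrow> nat list list set" where
  "SHST a b n =
     {T. map length T = n * (a + 1) # replicate b n \<and> semistandard T \<and>
         (\<forall>k \<in> {1..a + b + 1}. count_list (concat T) k = n)}"

definition rw :: "nat list list \<Rightarrow> nat list" where
  "rw T = concat (rev T)"

inductive delete_pair :: "nat \<Rightarrow> nat list \<Rightarrow> nat list \<Rightarrow> bool" for j where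
  "delete_pair j (u @ [Suc j, j] @ v) (u @ v)"

definition depth :: "nat \<Rightarrow> nat list \<Rightarrow> nat" where
  "depth j w =
     (THE s. \<exists>r. (delete_pair j)\<^sup>*\<^sup>* (filter (\<lambda>x. x = j \<or> x = Suc j) w)
                   (replicate r j @ replicate s (Suc j)))"

text \<open>The sequence \<open>(depth\<^sub>1(w), depth\<^sub>2(w), \<dots>)\<close>, indexed from \<open>0\<close>.\<close>

definition depth_seq :: "nat list \<Rightarrow> nat \<Rightarrow> nat" where
  "depth_seq w i = depth (Suc i) w"

text \<open>The remaining facts show that the definite description in \<^const>\<open>depth\<close> is well defined:
  the deletion process can always be completed, and its result does not depend on the order of
  the deletions.\<close>

fun reduced :: "nat \<Rightarrow> nat list \<Rightarrow> nat \<times> nat" where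
  "reduced j [] = (0, 0)"
| "reduced j (x # xs) =
     (let (r, s) = reduced j xs in
      if x = j then (Suc r, s) else if r = 0 then (0, Suc s) else (r - 1, s))"

lemma reduced_append_cong: "reduced j v = reduced j v' \<Longrightarrow> reduced j (u @ v) = reduced j (u @ v')"
  by (induction u) auto

lemma reduced_delete_pair: "delete_pair j w w' \<Longrightarrow> reduced j w = reduced j w'"
  by (erule delete_pair.cases) (auto intro!: reduced_append_cong split: prod.split)

lemma reduced_delete_pairs: "(delete_pair j)\<^sup>*\<^sup>* w w' \<Longrightarrow> reduced j w = reduced j w'"
  by (induction rule: rtranclp_induct) (auto dest: reduced_delete_pair)

lemma reduced_normal: "reduced j (replicate r j @ replicate s (Suc j)) = (r, s)"
proof -
  have "reduced j (replicate s (Suc j)) = (0, s)" by (induction s) auto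
  then show ?thesis by (induction r) auto
qed

lemma delete_pair_Cons: "delete_pair j w w' \<Longrightarrow> delete_pair j (x # w) (x # w')"
  by (erule delete_pair.cases) (metis append_Cons delete_pair.intros)

lemma delete_pairs_Cons: "(delete_pair j)\<^sup>*\<^sup>* w w' \<Longrightarrow> (delete_pair j)\<^sup>*\<^sup>* (x # w) (x # w')"
  by (induction rule: rtranclp_induct) (auto intro: rtranclp.rtrancl_into_rtrancl delete_pair_Cons)

lemma delete_pairs_normal_form_ex:
  assumes "set w \<subseteq> {j, Suc j}"
  shows "\<exists>r s. (delete_pair j)\<^sup>*\<^sup>* w (replicate r j @ replicate s (Suc j))"
  using assms
proof (induction w)
  case Nil
  have "(delete_pair j)\<^sup>*\<^sup>* [] (replicate 0 j @ replicate 0 (Suc j))" by simp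
  then show ?case by blast
next
  case (Cons x w)
  then obtain r s where "(delete_pair j)\<^sup>*\<^sup>* w (replicate r j @ replicate s (Suc j))" by auto
  then have *: "(delete_pair j)\<^sup>*\<^sup>* (x # w) (x # replicate r j @ replicate s (Suc j))"
    by (rule delete_pairs_Cons)
  consider "x = j" | "x = Suc j" "r = 0" | r' where "x = Suc j" "r = Suc r'"
    using Cons.prems by (cases r) auto
  then show ?case
  proof cases
    case 1
    then have "x # replicate r j @ replicate s (Suc j) = replicate (Suc r) j @ replicate s (Suc j)"
      by simp
    then show ?thesis using * by metis
  next
    case 2
    then have "x # replicate r j @ replicate s (Suc j) = replicate 0 j @ replicate (Suc s) (Suc j)"
      by simp
    then show ?thesis using * by metis
  next
    case 3
    have "delete_pair j ([] @ [Suc j, j] @ (replicate r' j @ replicate s (Suc j)))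
            ([] @ (replicate r' j @ replicate s (Suc j)))"
      by (rule delete_pair.intros)
    then have "delete_pair j (x # replicate r j @ replicate s (Suc j))
                 (replicate r' j @ replicate s (Suc j))"
      using 3 by simp
    then show ?thesis using * by (meson rtranclp.rtrancl_into_rtrancl)
  qed
qed

lemma depth_well_defined:
  "\<exists>!s. \<exists>r. (delete_pair j)\<^sup>*\<^sup>* (filter (\<lambda>x. x = j \<or> x = Suc j) w)
               (replicate r j @ replicate s (Suc j))"
proof -
  have "set (filter (\<lambda>x. x = j \<or> x = Suc j) w) \<subseteq> {j, Suc j}" by auto
  then obtain r s where
    "(delete_pair j)\<^sup>*\<^sup>* (filter (\<lambda>x. x = j \<or> x = Suc j) w) (replicate r j @ replicate s (Suc j))"
    using delete_pairs_normal_form_ex by blast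
  then show ?thesis
    by (metis reduced_delete_pairs reduced_normal snd_conv)
qed

end

theory Submission
  imports Defs "HOL-Library.Sublist"
begin

text \<open>The depth is the maximum, over all suffixes \<open>v\<close> of the word, of the number of letters
  \<open>j + 1\<close> minus the number of letters \<open>j\<close> in \<open>v\<close>. The part of the first row exceeding \<open>j\<close> is a
  suffix realising the claimed value. For the upper bound, let a suffix begin in a lower row \<open>S\<close>.
  As \<open>j\<close> occurs \<open>n\<close> times in total, it suffices that the letters \<open>j + 1\<close> in the lower rows down
  to \<open>S\<close>, together with the letters \<open>j\<close> in the rows from \<open>S\<close> on, number at most \<open>n\<close>. By column
  strictness no two of these lie in the same column, and the lower rows have only \<open>n\<close> columns.
  Counting boxes, no letter exceeds \<open>a + b + 1\<close>, so for larger \<open>j\<close> the depth is \<open>0\<close>.\<close>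

lemma depth_eq_reduced: "depth j w = snd (reduced j (filter (\<lambda>x. x = j \<or> x = Suc j) w))"
proof -
  let ?w = "filter (\<lambda>x. x = j \<or> x = Suc j) w"
  have "\<exists>r. (delete_pair j)\<^sup>*\<^sup>* ?w (replicate r j @ replicate (depth j w) (Suc j))"
    unfolding depth_def by (rule theI'[OF depth_well_defined])
  then show ?thesis
    by (metis reduced_delete_pairs reduced_normal snd_conv)
qed

lemma count_list_reduced:
  "reduced j (filter (\<lambda>x. x = j \<or> x = Suc j) w) = (r, s) \<Longrightarrow>
     count_list w (Suc j) + r = count_list w j + s"
  by (induction w arbitrary: r s) (auto split: prod.splits if_splits)

lemma depth_le_iff:
  "depth j w \<le> m \<longleftrightarrow> (\<forall>v. suffix v w \<longrightarrow> count_list v (Suc j) \<le> count_list v j + m)"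
proof (induction w)
  case Nil
  then show ?case by (simp add: depth_eq_reduced)
next
  case (Cons x w)
  obtain r s where reduced_w: "reduced j (filter (\<lambda>x. x = j \<or> x = Suc j) w) = (r, s)"
    by fastforce
  have "depth j (x # w) \<le> m \<longleftrightarrow>
      count_list (x # w) (Suc j) \<le> count_list (x # w) j + m \<and> depth j w \<le> m"
    using count_list_reduced[OF reduced_w] reduced_w by (auto simp: depth_eq_reduced)
  then show ?case
    using Cons.IH by (auto simp: suffix_Cons)
qed

lemma depth_eq_0: "Suc j \<notin> set w \<Longrightarrow> depth j w = 0"
  by (induction w) (auto simp: depth_eq_reduced split: prod.splits)

lemma count_list_sorted_le_depth:
  assumes "sorted R"
  shows "count_list R (Suc j) \<le> depth j (u @ R)"
proof -
  define p q where "p = takeWhile (\<lambda>x. x \<le> j) R" and "q = dropWhile (\<lambda>x. x \<le> j) R"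
  have R: "R = p @ q" by (simp add: p_def q_def)
  have "Suc j \<notin> set p" by (auto simp: p_def dest: set_takeWhileD)
  then have "count_list R (Suc j) = count_list q (Suc j)"
    by (simp add: R count_list_0_iff)
  also have "\<dots> \<le> count_list q j + depth j (u @ R)"
    using depth_le_iff[of j "u @ R" "depth j (u @ R)"] by (simp add: R suffix_def)
  also have "count_list q j = 0"
    using assms unfolding q_def by (induction R) (auto simp: count_list_0_iff)
  finally show ?thesis by simp
qed

definition row_above :: "'a::order list \<Rightarrow> 'a list \<Rightarrow> bool" where
  "row_above p q \<longleftrightarrow> length q \<le> length p \<and> (\<forall>c < length q. p ! c < q ! c)"

definition columns_containing :: "'a \<Rightarrow> 'a list list \<Rightarrow> nat set" where
  "columns_containing x Rs = (\<Union>p \<in> set Rs. {c. c < length p \<and> p ! c = x})"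

lemma transp_row_above: "transp row_above"
  unfolding row_above_def
  by (intro transpI conjI; meson order.strict_trans order.strict_trans2 order.trans)

lemma semistandard_imp_sorted_wrt_row_above:
  assumes "semistandard T" and "sorted_wrt (\<ge>) (map length T)"
  shows "sorted_wrt row_above T"
  unfolding sorted_wrt_iff_nth_Suc_transp[OF transp_row_above]
  using assms by (auto simp: semistandard_def row_above_def sorted_wrt_iff_nth_less)

lemma finite_columns_containing: "finite (columns_containing x Rs)"
  by (simp add: columns_containing_def)

lemma count_list_concat_eq_card_columns:
  "sorted_wrt row_above Rs \<Longrightarrow> count_list (concat Rs) x = card (columns_containing x Rs)"
proof (induction Rs)
  case Nil
  then show ?case by (simp add: columns_containing_def)
next
  case (Cons R Rs)
  let ?C = "{c. c < length R \<and> R ! c = x}"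
  have "?C \<inter> columns_containing x Rs = {}"
    using Cons.prems by (fastforce simp: columns_containing_def row_above_def)
  moreover have "columns_containing x (R # Rs) = ?C \<union> columns_containing x Rs"
    by (simp add: columns_containing_def)
  moreover have "count_list R x = card ?C"
    by (simp add: count_list_eq_length_filter length_filter_conv_card eq_commute)
  ultimately show ?case
    using Cons by (simp add: card_Un_disjoint finite_columns_containing)
qed

lemma columns_containing_disjoint:
  assumes "sorted_wrt row_above (A @ S # B)" and "x < y"
  shows "columns_containing y (A @ [S]) \<inter> columns_containing x (S # B) = {}"
proof -
  have "q ! c \<noteq> x"
    if "p \<in> set (A @ [S])" "q \<in> set (S # B)" "c < length q" "p ! c = y" for p q c
  proof -
    have "p = q \<or> row_above p q"
      using assms(1) that(1,2) by (auto simp: sorted_wrt_append)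
    then have "y \<le> q ! c"
      using that(3,4) by (auto simp: row_above_def)
    then show ?thesis using \<open>x < y\<close> by auto
  qed
  then show ?thesis
    by (fastforce simp: columns_containing_def)
qed

lemma count_list_split_rows_le:
  assumes "sorted_wrt row_above (A @ S # B)" and "\<forall>p \<in> set (A @ S # B). length p \<le> m"
    and "x < y"
  shows "count_list (concat (A @ [S])) y + count_list (concat (S # B)) x \<le> m"
proof -
  let ?P = "columns_containing y (A @ [S])" and ?Q = "columns_containing x (S # B)"
  have "sorted_wrt row_above (A @ [S])" and "sorted_wrt row_above (S # B)"
    using assms(1) by (auto simp: sorted_wrt_append)
  then have "count_list (concat (A @ [S])) y + count_list (concat (S # B)) x = card ?P + card ?Q"
    by (simp only: count_list_concat_eq_card_columns)
  also have "\<dots> = card (?P \<union> ?Q)"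
    using columns_containing_disjoint[OF assms(1,3)]
    by (simp add: card_Un_disjoint finite_columns_containing)
  also have "\<dots> \<le> card {..<m}"
    using assms(2) by (intro card_mono) (auto simp: columns_containing_def intro: less_le_trans)
  finally show ?thesis by simp
qed

lemma rw_Cons: "rw (R # Rs) = rw Rs @ R"
  by (simp add: rw_def)

lemma suffix_rw_Cons:
  "suffix v (rw (R # Rs)) \<longleftrightarrow> suffix v R \<or> (\<exists>v'. v = v' @ R \<and> suffix v' (rw Rs))"
  by (auto simp: rw_Cons suffix_append)

lemma count_list_rw: "count_list (rw T) x = count_list (concat T) x"
  by (induction T) (auto simp: rw_def)

lemma suffix_rwE:
  assumes "suffix v (rw T)" and "T \<noteq> []"
  obtains A S B q where "T = A @ S # B" "suffix q S" "v = q @ rw A"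
  using assms(2,1)
proof (induction T arbitrary: v thesis rule: list_nonempty_induct)
  case (single R)
  then show ?case by (force simp: rw_def)
next
  case (cons R Rs)
  from cons.prems(2) consider (first_row) "suffix v R"
    | (lower_row) v' where "v = v' @ R" "suffix v' (rw Rs)"
    by (auto simp: suffix_rw_Cons)
  then show ?case
  proof cases
    case first_row
    then show ?thesis using cons.prems(1)[of "[]" R Rs v] by (simp add: rw_def)
  next
    case lower_row
    obtain A S B q where "Rs = A @ S # B" "suffix q S" "v' = q @ rw A"
      using cons.IH lower_row(2) by blast
    then show ?thesis using lower_row(1) cons.prems(1)[of "R # A" S B q] by (simp add: rw_Cons)
  qed
qed

lemma count_list_suffix_rw_le:
  assumes "sorted_wrt row_above Rs" and "\<forall>p \<in> set Rs. length p \<le> m" and "suffix v (rw Rs)"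
    and "x < y"
  shows "count_list v y + count_list (rw Rs) x \<le> count_list v x + m"
proof (cases "Rs = []")
  case True
  then show ?thesis using assms(3) by (simp add: rw_def)
next
  case False
  then obtain A S B q where Rs: "Rs = A @ S # B" and "suffix q S" and v: "v = q @ rw A"
    using assms(3) suffix_rwE by metis
  then obtain p where S: "S = p @ q" by (auto simp: suffix_def)
  have "count_list (concat (A @ [S])) y + count_list (concat (S # B)) x \<le> m"
    using assms(1,2,4) unfolding Rs by (rule count_list_split_rows_le)
  then show ?thesis by (simp add: Rs S v count_list_rw)
qed

lemma depth_rw_eq_count_list_hd:
  assumes "sorted R" and "sorted_wrt row_above Rs"
    and "\<forall>p \<in> set Rs. length p \<le> count_list (concat (R # Rs)) j"
  shows "depth j (rw (R # Rs)) = count_list R (Suc j)"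
proof (rule antisym)
  have "count_list v (Suc j) \<le> count_list v j + count_list R (Suc j)"
    if "suffix v (rw (R # Rs))" for v
  proof -
    from that consider (first_row) "suffix v R"
      | (lower_row) v' where "v = v' @ R" "suffix v' (rw Rs)"
      by (auto simp: suffix_rw_Cons)
    then show ?thesis
    proof cases
      case first_row
      then show ?thesis by (auto simp: suffix_def)
    next
      case lower_row
      then show ?thesis
        using count_list_suffix_rw_le[OF assms(2,3) lower_row(2), of j "Suc j"]
        by (simp add: count_list_rw)
    qed
  qed
  then show "depth j (rw (R # Rs)) \<le> count_list R (Suc j)"
    by (simp add: depth_le_iff)
  show "count_list R (Suc j) \<le> depth j (rw (R # Rs))"
    using assms(1) by (simp add: rw_Cons count_list_sorted_le_depth)
qed

lemma set_subset_if_sum_count_list_eq_length: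
  assumes "finite K" and "(\<Sum>k\<in>K. count_list xs k) = length xs"
  shows "set xs \<subseteq> K"
proof -
  have "length (filter (\<lambda>x. x \<in> K) xs) = (\<Sum>k\<in>K. count_list (filter (\<lambda>x. x \<in> K) xs) k)"
    using assms(1) by (intro sum_count_set[symmetric]) auto
  also have "\<dots> = (\<Sum>k\<in>K. count_list xs k)"
    by (intro sum.cong)
      (auto simp: count_list_eq_length_filter intro!: arg_cong[where f = length] filter_cong)
  finally have "length (filter (\<lambda>x. x \<in> K) xs) = length xs"
    using assms(2) by simp
  then show ?thesis
    using length_filter_less[of _ xs "\<lambda>x. x \<in> K"] by fastforce
qed

lemma SHST_set_concat:
  assumes "T \<in> SHST a b n"
  shows "set (concat T) \<subseteq> {1..a + b + 1}"
proof (rule set_subset_if_sum_count_list_eq_length)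
  have shape: "map length T = n * (a + 1) # replicate b n"
    and content: "\<forall>k \<in> {1..a + b + 1}. count_list (concat T) k = n"
    using assms by (auto simp: SHST_def)
  have "length (concat T) = n * (a + 1) + b * n"
    using shape by (simp add: length_concat sum_list_replicate)
  then show "(\<Sum>k\<in>{1..a + b + 1}. count_list (concat T) k) = length (concat T)"
    using content by (simp add: algebra_simps)
qed simp

lemma SHST_rowsE:
  assumes "T \<in> SHST a b n"
  obtains R Rs where "T = R # Rs" "sorted R" "sorted_wrt row_above Rs"
    "\<forall>p \<in> set Rs. length p = n"
proof -
  have shape: "map length T = n * (a + 1) # replicate b n" and ss: "semistandard T"
    using assms by (auto simp: SHST_def)
  obtain R Rs where T: "T = R # Rs" and Rs: "map length Rs = replicate b n"
    using shape by (cases T) auto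
  have "sorted_wrt (\<ge>) (map length T)"
    unfolding shape by (auto simp: sorted_wrt_iff_nth_less nth_Cons split: nat.split)
  then have "sorted_wrt row_above T"
    by (rule semistandard_imp_sorted_wrt_row_above[OF ss])
  moreover have "\<forall>p \<in> set Rs. length p = n"
    using Rs by (metis image_eqI in_set_replicate list.set_map)
  moreover have "sorted R"
    using ss by (simp add: T semistandard_def)
  ultimately show ?thesis using that T by simp
qed

lemma depth_rw_SHST:
  assumes "T \<in> SHST a b n" and "1 \<le> j"
  shows "depth j (rw T) = count_list (hd T) (Suc j)"
proof (cases "j \<le> a + b + 1")
  case True
  obtain R Rs where T: "T = R # Rs" and "sorted R" "sorted_wrt row_above Rs"
    and len: "\<forall>p \<in> set Rs. length p = n"
    by (rule SHST_rowsE[OF assms(1)])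
  moreover have "count_list (concat T) j = n"
    using assms True by (simp add: SHST_def)
  ultimately show ?thesis
    by (simp add: depth_rw_eq_count_list_hd)
next
  case False
  then have "Suc j \<notin> set (concat T)"
    using SHST_set_concat[OF assms(1)] by auto
  moreover have "T \<noteq> []"
    using SHST_rowsE[OF assms(1)] by blast
  ultimately show ?thesis
    by (auto simp: depth_eq_0 rw_def count_list_0_iff dest: hd_in_set)
qed

theorem mainTheorem5:
  fixes a b n :: nat and T :: "nat list list"
  assumes "n \<ge> 1" and "T \<in> SHST a b n"
  shows "(\<forall>T' \<in> SHST a b n. hd T' = hd T \<longrightarrow> depth_seq (rw T') = depth_seq (rw T)) \<and>
         (\<forall>j \<in> {1..a + b}. depth j (rw T) = count_list (hd T) (j + 1))"
  using assms(2) by (auto simp: depth_seq_def fun_eq_iff depth_rw_SHST)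

end
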